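(* For every $n\in\mathbb{N}$, $$\sum_{k\in\mathrm{Reg}_n}\cos^2\left(\frac{k\pi}{n}\right)=\frac{\varrho(n)+\overline{\mu}(n)}{2},$$ where $\overline{\mu}(n)=\sum_{d\,\|\,n}\mu(d)$ is the characteristic function of the squarefull integers $n$.
   Context: $\mathbb{N}=\{1,2,\ldots\}$. An integer $k$ is called regular (mod $n$) if there exists $x\in\mathbb{Z}$ with $k^2x\equiv k\pmod n$, $\mathrm{Reg}_n=\{k\in\mathbb{N}:1\le k\le n,\ k\text{ is regular (mod }n)\}$, and $\varrho(n)=\#\mathrm{Reg}_n$. $d\,\|\,n$ means that $d$ is a unitary divisor of $n$, i.e. $d\ge1$, $d\mid n$ and $\gcd(d,n/d)=1$. $\mu$ is the Möbius function. A positive integer $n$ is squarefull if $p^2\mid n$ for every prime $p\mid n$ (so $1$ is squarefull). *)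

theory Defs
  imports Complex_Main "HOL-Computational_Algebra.Squarefree" "HOL-Number_Theory.Cong"
begin

definition regular_mod :: "int \<Rightarrow> nat \<Rightarrow> bool" where
  "regular_mod k n \<longleftrightarrow> (\<exists>x::int. [k\<^sup>2 * x = k] (mod (int n)))"

definition Reg :: "nat \<Rightarrow> nat set" where
  "Reg n = {k. 1 \<le> k \<and> k \<le> n \<and> regular_mod (int k) n}"

definition varrho :: "nat \<Rightarrow> nat" where
  "varrho n = card (Reg n)"

definition unitary_divisor :: "nat \<Rightarrow> nat \<Rightarrow> bool" where
  "unitary_divisor d n \<longleftrightarrow> 1 \<le> d \<and> d dvd n \<and> gcd d (n div d) = 1"

definition moebius_mu :: "nat \<Rightarrow> int" where
  "moebius_mu n = (if squarefree n then (-1) ^ card (prime_factors n) else 0)"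

definition mu_bar :: "nat \<Rightarrow> int" where
  "mu_bar n = (\<Sum>d | unitary_divisor d n. moebius_mu d)"

definition squarefull :: "nat \<Rightarrow> bool" where
  "squarefull n \<longleftrightarrow> 0 < n \<and> (\<forall>p. prime p \<longrightarrow> p dvd n \<longrightarrow> p\<^sup>2 dvd n)"

end

theory Submission
  imports Defs
begin

text \<open>
  Since \<open>2 cos\<^sup>2 x = 1 + cos (2x)\<close>, it suffices to show that the sum of \<open>e(k/n)\<close>
  over the regular \<open>k\<close> is 1 or 0 according to whether \<open>n\<close> is squarefull.
  A sum of \<open>e(k/n)\<close> over a set of residues invariant under a nonzero shift vanishes.
  If a prime \<open>p\<close> divides \<open>n\<close> exactly once, every residue is regular mod \<open>p\<close>, so the
  regular residues are invariant under the shift by \<open>n/p\<close>.  If \<open>n\<close> is squarefull, the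
  regular \<open>k\<close> with \<open>gcd(k, n) = d < n\<close> are those divisible by \<open>d\<close> and coprime to
  \<open>n/d\<close>, and they are invariant under the shift by \<open>n/p\<close> for any prime \<open>p\<close> dividing
  \<open>n/d\<close>, so that only \<open>k = n\<close> contributes.
\<close>

section \<open>Exponential sums over shift-invariant sets of residues\<close>

lemma cis_shift_neq_1:
  fixes s n :: nat
  assumes "0 < s" "s < n"
  shows "cis (2 * pi * real s / real n) \<noteq> 1"
proof
  assume "cis (2 * pi * real s / real n) = 1"
  then have "cos (2 * pi * real s / real n) = 1"
    by (metis cis.sel(1) one_complex.sel(1))
  then obtain j :: int where "2 * pi * real s / real n = of_int j * 2 * pi"
    using cos_one_2pi_int by blast
  then have "real s = of_int j * real n"
    using assms by (simp add: field_simps)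
  then have "int s = j * int n"
    by (metis of_int_eq_iff of_int_mult of_int_of_nat_eq)
  then have "int n dvd int s" by simp
  then show False using assms by (auto dest: dvd_imp_le)
qed

text \<open>The shift by \<open>s\<close> permutes the index set and multiplies each term by e(s/n),
  so the sum equals e(s/n) times itself, where e(s/n) is not 1.\<close>

lemma sum_cis_shift_invariant:
  fixes n s :: nat
  assumes s: "0 < s" "s < n"
    and step: "\<And>k. P k \<Longrightarrow> P (k + s)"
    and periodic: "\<And>k. P (k + n) \<Longrightarrow> P k"
  shows "(\<Sum>k | 1 \<le> k \<and> k \<le> n \<and> P k. cis (2 * pi * real k / real n)) = 0"
proof -
  let ?T = "{k. 1 \<le> k \<and> k \<le> n \<and> P k}"
  let ?e = "\<lambda>k. cis (2 * pi * real k / real n)"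
  \<comment> \<open>The representatives are 1, ..., n, so \<open>n\<close> itself must stay fixed
    under reduction; \<open>mod\<close> would send it to 0.\<close>
  let ?f = "\<lambda>k. if k + s \<le> n then k + s else k + s - n"
  have fin: "finite ?T" by (rule finite_subset[of _ "{..n}"]) auto
  have inj: "inj_on ?f ?T" using s by (auto simp: inj_on_def split: if_splits)
  have "?f k \<in> ?T" if k: "k \<in> ?T" for k
  proof (cases "k + s \<le> n")
    case True
    then show ?thesis using k step by auto
  next
    case False
    then have "P (k + s - n)" using k step periodic[of "k + s - n"] by simp
    then show ?thesis using False k s by auto
  qed
  \<comment> \<open>An injective self-map of a finite set is onto, so invariance under the inverse
    shift comes for free.\<close>
  then have "?f ` ?T \<subseteq> ?T" by (rule image_subsetI)
  then have "?f ` ?T = ?T" by (rule endo_inj_surj[OF fin _ inj])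
  then have bij: "bij_betw ?f ?T ?T" by (rule bij_betw_imageI[OF inj])
  have e: "?e (?f k) = ?e s * ?e k" for k
  proof (cases "k + s \<le> n")
    case True
    then show ?thesis by (simp add: cis_mult add_divide_distrib algebra_simps)
  next
    case False
    then have "2 * pi * real (k + s - n) / real n
        = 2 * pi * real s / real n + 2 * pi * real k / real n - 2 * pi"
      using s by (simp add: of_nat_diff field_simps)
    moreover have "cis (x - 2 * pi) = cis x" for x
      by (simp add: cis_divide[symmetric])
    ultimately show ?thesis using False by (simp add: cis_mult)
  qed
  have "sum ?e ?T = (\<Sum>k\<in>?T. ?e (?f k))"
    by (rule sum.reindex_bij_betw[OF bij, symmetric])
  also have "\<dots> = ?e s * sum ?e ?T" by (simp only: e sum_distrib_left)
  finally show ?thesis using cis_shift_neq_1[OF s] by (simp add: mult_cancel_right1)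
qed

section \<open>Regularity modulo primes, coprime products and general \<open>n\<close>\<close>

lemma regular_mod_prime:
  assumes "prime p"
  shows "regular_mod k p"
\<comment> \<open>The residues mod \<open>p\<close> form a field: the zero class takes
  \<open>x = 0\<close>, any other class its inverse.\<close>
proof (cases "int p dvd k")
  case True
  then have "[k\<^sup>2 * 0 = k] (mod int p)" by (simp add: cong_def)
  then show ?thesis unfolding regular_mod_def by blast
next
  case False
  then have "coprime k (int p)"
    using assms prime_imp_coprime[of "int p" k] by (simp add: coprime_commute)
  then obtain x where "[k * x = 1] (mod int p)" using cong_solve_coprime_int by blast
  then have "[k * (k * x) = k * 1] (mod int p)" by (rule cong_scalar_left)
  then have "[k\<^sup>2 * x = k] (mod int p)" by (simp add: power2_eq_square mult.assoc)
  then show ?thesis unfolding regular_mod_def by blast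
qed

lemma regular_mod_cong:
  assumes "[k = l] (mod int n)" "regular_mod k n"
  shows "regular_mod l n"
proof -
  obtain x where "[k\<^sup>2 * x = k] (mod int n)" using assms by (auto simp: regular_mod_def)
  moreover have "[k\<^sup>2 * x = l\<^sup>2 * x] (mod int n)"
    by (intro cong_mult cong_pow assms cong_refl)
  ultimately have "[l\<^sup>2 * x = l] (mod int n)" using assms(1) by (meson cong_sym cong_trans)
  then show ?thesis by (auto simp: regular_mod_def)
qed

text \<open>A solution \<open>x\<close> modulo the product reduces to each factor; conversely, the
  Chinese remainder theorem glues solutions for the two factors into one.\<close>

lemma regular_mod_coprime_mult:
  assumes "coprime a b"
  shows "regular_mod k (a * b) \<longleftrightarrow> regular_mod k a \<and> regular_mod k b"
proof
  assume "regular_mod k (a * b)"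
  then obtain x where x: "[k\<^sup>2 * x = k] (mod int a * int b)" by (auto simp: regular_mod_def)
  then show "regular_mod k a \<and> regular_mod k b"
    using cong_modulus_mult[OF x] cong_modulus_mult[of _ _ "int b" "int a"]
    by (auto simp: regular_mod_def mult.commute)
next
  assume "regular_mod k a \<and> regular_mod k b"
  then obtain x y where xy: "[k\<^sup>2 * x = k] (mod int a)" "[k\<^sup>2 * y = k] (mod int b)"
    by (auto simp: regular_mod_def)
  have cop: "coprime (int a) (int b)" using assms by simp
  then obtain z where z: "[z = x] (mod int a)" "[z = y] (mod int b)"
    using binary_chinese_remainder_int by blast
  have "[k\<^sup>2 * z = k] (mod int a)" "[k\<^sup>2 * z = k] (mod int b)"
    using xy z by (meson cong_scalar_left cong_trans)+
  then have "[k\<^sup>2 * z = k] (mod int a * int b)" using cop coprime_cong_mult by blast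
  then show "regular_mod k (a * b)" by (auto simp: regular_mod_def)
qed

text \<open>Write \<open>k = g * a\<close> and \<open>n = g * b\<close> with \<open>a\<close>,
  \<open>b\<close> coprime. Since k^2 x - k = g a (k x - 1), the factors \<open>g\<close> and
  \<open>a\<close> cancel, and what remains is invertibility of \<open>k\<close> mod
  \<open>b\<close>.\<close>

lemma regular_mod_iff_coprime:
  fixes k n :: nat
  assumes "0 < n"
  shows "regular_mod (int k) n \<longleftrightarrow> coprime k (n div gcd k n)"
proof -
  define g where "g = gcd k n"
  have g: "g > 0" using assms by (simp add: g_def)
  obtain a b where ab: "k = g * a" "n = g * b" "coprime a b"
    using gcd_coprime_exists[of k n] assms unfolding g_def by (metis gcd_eq_0_iff mult.commute not_gr0)
  have b: "n div gcd k n = b" using ab(2) g unfolding g_def[symmetric] by simp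
  have "regular_mod (int k) n \<longleftrightarrow> (\<exists>x. int b dvd int k * x - 1)"
  proof -
    have "[(int k)\<^sup>2 * x = int k] (mod int n) \<longleftrightarrow> int b dvd int k * x - 1" for x
    proof -
      have "(int k)\<^sup>2 * x - int k = int g * (int a * (int k * x - 1))"
        by (simp add: ab(1) power2_eq_square algebra_simps)
      then have "[(int k)\<^sup>2 * x = int k] (mod int n) \<longleftrightarrow> int b dvd int a * (int k * x - 1)"
        using g by (simp add: cong_iff_dvd_diff ab(2))
      also have "\<dots> \<longleftrightarrow> int b dvd int k * x - 1"
        using ab(3) by (intro coprime_dvd_mult_right_iff) (simp add: coprime_commute)
      finally show ?thesis .
    qed
    then show ?thesis by (simp add: regular_mod_def)
  qed
  also have "\<dots> \<longleftrightarrow> coprime (int k) (int b)"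
    using coprime_iff_invertible_int[of "int k" "int b"]
    by (simp add: cong_iff_dvd_diff)
  finally show ?thesis by (simp add: b)
qed

section \<open>Squarefull numbers and the exponential sum over regular residues\<close>

lemma not_squarefullE:
  assumes "0 < n" "\<not> squarefull n"
  obtains p m where "prime p" "n = p * m" "coprime p m" "0 < m"
proof -
  obtain p where p: "prime p" "p dvd n" "\<not> p\<^sup>2 dvd n"
    using assms by (auto simp: squarefull_def)
  then obtain m where m: "n = p * m" by blast
  have "\<not> p dvd m" using p m by (auto simp: power2_eq_square)
  then show ?thesis using that p m assms prime_imp_coprime by auto
qed

text \<open>Removing one factor \<open>p\<close> leaves another \<open>p\<close> behind and does not
  affect the other primes. Hence adding \<open>n div p\<close> changes no residue modulo a prime
  divisor of \<open>n\<close>, and so preserves coprimality to any divisor of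
  \<open>n\<close>.\<close>

lemma squarefull_prime_dvd_div:
  assumes "squarefull n" "prime p" "p dvd n" "prime q" "q dvd n"
  shows "q dvd n div p"
proof -
  obtain m where m: "n = p * m" using assms by blast
  have "p > 0" using assms by (simp add: prime_gt_0_nat)
  have "q dvd m"
  proof (cases "q = p")
    case True
    have "p\<^sup>2 dvd p * m" using assms m by (auto simp: squarefull_def)
    then show ?thesis using True \<open>p > 0\<close> by (simp add: power2_eq_square)
  next
    case False
    then show ?thesis using assms m by (metis prime_dvd_mult_iff primes_dvd_imp_eq)
  qed
  then show ?thesis using m \<open>p > 0\<close> by simp
qed

lemma sum_cis_Reg_not_squarefull:
  assumes "0 < n" "\<not> squarefull n"
  shows "(\<Sum>k\<in>Reg n. cis (2 * pi * real k / real n)) = 0"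
proof -
  obtain p m where pm: "prime p" "n = p * m" "coprime p m" "0 < m"
    using not_squarefullE[OF assms] .
  \<comment> \<open>The factor \<open>p\<close> imposes no condition, so regularity has period
    \<open>m\<close>, a proper divisor of \<open>n\<close>.\<close>
  have reg: "regular_mod k n \<longleftrightarrow> regular_mod k m" for k
    using regular_mod_coprime_mult[OF pm(3)] regular_mod_prime[OF pm(1)] pm(2) by simp
  show ?thesis unfolding Reg_def
  proof (rule sum_cis_shift_invariant[where s = m])
    show "0 < m" "m < n" using pm prime_gt_1_nat[OF pm(1)] by auto
    show "regular_mod (int (k + m)) n" if "regular_mod (int k) n" for k
      using that regular_mod_cong[of "int k" "int (k + m)" m] by (simp add: reg cong_def)
    show "regular_mod (int k) n" if "regular_mod (int (k + n)) n" for k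
      using that regular_mod_cong[of "int (k + n)" "int k" n] by (simp add: cong_def)
  qed
qed

lemma sum_cis_Reg_gcd:
  assumes n: "squarefull n" and d: "d dvd n" "d \<noteq> n"
  shows "(\<Sum>k | k \<in> Reg n \<and> gcd k n = d. cis (2 * pi * real k / real n)) = 0"
proof -
  have n0: "0 < n" using n by (simp add: squarefull_def)
  obtain b where b: "n = d * b" using d by blast
  have d0: "0 < d" using b n0 by (cases d) auto
  \<comment> \<open>This is where \<open>d \<noteq> n\<close> enters: it gives
    \<open>b \<noteq> 1\<close>.\<close>
  obtain p where p: "prime p" "p dvd b" using b d by (metis mult.right_neutral prime_factor_nat)
  have pn: "p dvd n" using p b by simp
  have nd: "n div d = b" using b d0 by simp
  \<comment> \<open>For the converse, a factor \<open>b\<close> coprime to \<open>k\<close> drops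
    out of the gcd: gcd(k, d b) = gcd(k, d) = d.\<close>
  have P: "regular_mod (int k) n \<and> gcd k n = d \<longleftrightarrow> d dvd k \<and> coprime k b" for k
  proof
    assume "regular_mod (int k) n \<and> gcd k n = d"
    then show "d dvd k \<and> coprime k b" using regular_mod_iff_coprime[OF n0] nd by auto
  next
    assume *: "d dvd k \<and> coprime k b"
    then have "gcd k n = d" by (simp add: b gcd_mult_right_right_cancel gcd_proj2_iff coprime_commute)
    then show "regular_mod (int k) n \<and> gcd k n = d" using * regular_mod_iff_coprime[OF n0] nd by auto
  qed
  have "(\<Sum>k | 1 \<le> k \<and> k \<le> n \<and> (d dvd k \<and> coprime k b). cis (2 * pi * real k / real n)) = 0"
  proof (rule sum_cis_shift_invariant[where s = "n div p"])
    show "0 < n div p" using n0 pn by (metis dvd_div_eq_0_iff not_gr0)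
    show "n div p < n" using n0 p prime_gt_1_nat by simp
    show "d dvd k + n div p \<and> coprime (k + n div p) b" if "d dvd k \<and> coprime k b" for k
    proof
      \<comment> \<open>Choosing \<open>p\<close> among the primes of \<open>b\<close>, not merely
        of \<open>n\<close>, makes the shift a multiple of \<open>d\<close>.\<close>
      have "n div p = d * (b div p)" using b p by (simp add: div_mult_swap)
      then show "d dvd k + n div p" using that by simp
      show "coprime (k + n div p) b"
      proof (rule ccontr)
        assume "\<not> coprime (k + n div p) b"
        then obtain q where q: "prime q" "q dvd k + n div p" "q dvd b"
          by (metis coprime_iff_gcd_eq_1 gcd_greatest_iff prime_factor_nat)
        have "q dvd n div p" using squarefull_prime_dvd_div[OF n p(1) pn q(1)] q b by simp
        then have "q dvd k" using q by (simp add: dvd_add_left_iff)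
        then show False using q that by (meson coprime_common_divisor not_prime_unit)
      qed
    qed
    show "d dvd k \<and> coprime k b" if "d dvd k + n \<and> coprime (k + n) b" for k
    proof -
      have "coprime k b" using that unfolding b
        by (metis coprime_iff_gcd_eq_1 gcd_add_mult gcd.commute add.commute)
      then show ?thesis using that b by (simp add: dvd_add_left_iff)
    qed
  qed
  then show ?thesis by (simp add: Reg_def P[symmetric] conj_assoc)
qed

lemma sum_cis_Reg_squarefull:
  assumes "squarefull n"
  shows "(\<Sum>k\<in>Reg n. cis (2 * pi * real k / real n)) = 1"
proof -
  have n0: "0 < n" using assms by (simp add: squarefull_def)
  let ?e = "\<lambda>k. cis (2 * pi * real k / real n)"
  have fin: "finite (Reg n)" by (rule finite_subset[of _ "{..n}"]) (auto simp: Reg_def)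
  \<comment> \<open>The class \<open>d = n\<close> is the only one that survives, and its single
    term is e(1) = 1.\<close>
  have top: "{k. k \<in> Reg n \<and> gcd k n = n} = {n}"
    using n0 by (auto simp: Reg_def regular_mod_iff_coprime Suc_le_eq) (metis dvd_imp_le gcd_dvd1 le_antisym)
  have "sum ?e (Reg n) = (\<Sum>d | d dvd n. \<Sum>k | k \<in> Reg n \<and> gcd k n = d. ?e k)"
    using n0 by (intro sum.group[symmetric] fin) auto
  also have "\<dots> = (\<Sum>d | d dvd n. if d = n then 1 else 0)"
    using n0 by (intro sum.cong refl) (auto simp: sum_cis_Reg_gcd[OF assms] top)
  also have "\<dots> = 1" using n0 by simp
  finally show ?thesis .
qed

section \<open>The Moebius sum over unitary divisors\<close>

lemma moebius_mu_prime_mult: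
  assumes "prime p" "coprime p d" "0 < d"
  shows "moebius_mu (p * d) = - moebius_mu d"
proof -
  have sq: "squarefree (p * d) \<longleftrightarrow> squarefree d"
    using assms by (metis squarefree_mult_coprime squarefree_multD(2) squarefree_prime)
  have "p \<noteq> 0" using assms by auto
  then have "prime_factors (p * d) = insert p (prime_factors d)"
    using assms prime_factors_product[of p d] by (simp add: prime_prime_factors)
  moreover have "p \<notin> prime_factors d"
    using assms by (auto simp: in_prime_factors_iff dest: coprime_common_divisor)
  ultimately show ?thesis by (simp add: moebius_mu_def sq)
qed

text \<open>In a factorization p m = d e with \<open>d\<close>, \<open>e\<close> coprime, the prime
  \<open>p\<close> divides either \<open>e\<close> or \<open>d\<close>; cancelling it leaves a
  coprime factorization of \<open>m\<close>.\<close>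

lemma unitary_divisor_prime_mult:
  assumes p: "prime p" and cop: "coprime p m" and m: "0 < m"
  shows "{d. unitary_divisor d (p * m)} = {d. unitary_divisor d m} \<union> (*) p ` {d. unitary_divisor d m}"
proof -
  have p0: "0 < p" using p by (simp add: prime_gt_0_nat)
  have iff: "unitary_divisor d n \<longleftrightarrow> (\<exists>e. n = d * e \<and> coprime d e)" if "0 < n" for d n :: nat
    using that by (auto simp: unitary_divisor_def coprime_iff_gcd_eq_1 Suc_le_eq)
  show ?thesis
  proof (intro equalityI subsetI)
    fix d assume "d \<in> {d. unitary_divisor d (p * m)}"
    then obtain e where e: "p * m = d * e" "coprime d e" using iff p0 m by auto
    then have "p dvd d * e" by (metis dvd_triv_left)
    then consider "p dvd d" | "p dvd e" using p prime_dvd_mult_iff by blast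
    then show "d \<in> {d. unitary_divisor d m} \<union> (*) p ` {d. unitary_divisor d m}"
    proof cases
      case 1
      then obtain d' where d': "d = p * d'" by blast
      then have "m = d' * e" "coprime d' e" using e p0 by auto
      then show ?thesis using d' iff[OF m] by auto
    next
      case 2
      then obtain e' where e': "e = p * e'" by blast
      then have "m = d * e'" "coprime d e'" using e p0 by auto
      then show ?thesis using iff[OF m] by auto
    qed
  next
    fix d assume "d \<in> {d. unitary_divisor d m} \<union> (*) p ` {d. unitary_divisor d m}"
    then consider "unitary_divisor d m" | d' where "d = p * d'" "unitary_divisor d' m" by auto
    then have "\<exists>e. p * m = d * e \<and> coprime d e"
    proof cases
      case 1
      then obtain e where "m = d * e" "coprime d e" using iff m by blast
      then show ?thesis using cop by (intro exI[of _ "p * e"]) (auto simp: coprime_commute)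
    next
      case 2
      then obtain e where "m = d' * e" "coprime d' e" using iff m by blast
      then show ?thesis using cop 2 by (intro exI[of _ e]) auto
    qed
    then show "d \<in> {d. unitary_divisor d (p * m)}" using iff p0 m by simp
  qed
qed

text \<open>If \<open>n\<close> is squarefull, a prime \<open>p\<close> dividing a unitary divisor
  \<open>d\<close> is absent from the cofactor, so p^2 divides \<open>d\<close>; only
  \<open>d = 1\<close> has a nonzero Moebius value. Otherwise n = p m with \<open>p\<close> coprime
  to \<open>m\<close>, and the terms for \<open>d\<close> and \<open>p * d\<close> cancel in
  pairs.\<close>

lemma mu_bar_eq:
  assumes n: "0 < n"
  shows "mu_bar n = (if squarefull n then 1 else 0)"
proof (cases "squarefull n")
  case True
  have "moebius_mu d = 0" if d: "unitary_divisor d n" "d \<noteq> 1" for d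
  proof -
    obtain e where e: "n = d * e" "coprime d e"
      using d by (auto simp: unitary_divisor_def coprime_iff_gcd_eq_1)
    obtain p where p: "prime p" "p dvd d" using d prime_factor_nat by blast
    have "\<not> p dvd e" using e p by (meson coprime_common_divisor not_prime_unit)
    then have "coprime (p\<^sup>2) e" using p by (simp add: prime_imp_coprime)
    moreover have "p\<^sup>2 dvd d * e" using True p e by (auto simp: squarefull_def)
    ultimately have "p\<^sup>2 dvd d" by (simp add: coprime_dvd_mult_left_iff)
    then have "\<not> squarefree d" using p by (meson not_prime_unit squarefreeD)
    then show ?thesis by (simp add: moebius_mu_def)
  qed
  moreover have "finite {d. unitary_divisor d n}"
    using n by (auto simp: unitary_divisor_def intro: finite_subset[of _ "{d. d dvd n}"])
  moreover have "unitary_divisor 1 n" by (simp add: unitary_divisor_def)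
  ultimately have "mu_bar n = moebius_mu 1"
    unfolding mu_bar_def by (subst sum.mono_neutral_right[of _ "{1}"]) auto
  then show ?thesis using True by (simp add: moebius_mu_def)
next
  case False
  obtain p m where pm: "prime p" "n = p * m" "coprime p m" "0 < m"
    using not_squarefullE[OF n False] .
  let ?D = "{d. unitary_divisor d m}"
  have p0: "p \<noteq> 0" using pm by auto
  have cop: "coprime p d" "0 < d" if "d \<in> ?D" for d
    using that pm(3) by (auto simp: unitary_divisor_def elim: coprime_imp_coprime)
  have fin: "finite ?D"
    using pm by (auto simp: unitary_divisor_def intro: finite_subset[of _ "{d. d dvd m}"])
  have disj: "?D \<inter> (*) p ` ?D = {}"
  proof -
    \<comment> \<open>Members of \<open>?D\<close> divide \<open>m\<close> and are therefore coprime
      to \<open>p\<close>.\<close>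
    have "p * d \<notin> ?D" for d
      using cop(1)[of "p * d"] pm(1) by auto
    then show ?thesis by blast
  qed
  have "mu_bar n = sum moebius_mu ?D + sum moebius_mu ((*) p ` ?D)"
    unfolding mu_bar_def pm(2) unitary_divisor_prime_mult[OF pm(1,3,4)]
    by (intro sum.union_disjoint fin finite_imageI disj)
  also have "sum moebius_mu ((*) p ` ?D) = (\<Sum>d\<in>?D. moebius_mu (p * d))"
    using p0 by (subst sum.reindex) (auto simp: inj_on_def)
  also have "\<dots> = - sum moebius_mu ?D"
    using moebius_mu_prime_mult[OF pm(1) cop] by (simp add: sum_negf)
  finally show ?thesis using False by simp
qed

theorem proposition5p4p1:
  fixes n :: nat
  assumes "1 \<le> n"
  shows "(\<Sum>k\<in>Reg n. (cos (real k * pi / real n))\<^sup>2)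
           = (real (varrho n) + real_of_int (mu_bar n)) / 2
         \<and> mu_bar n = (if squarefull n then 1 else 0)"
proof
  have n: "0 < n" using assms by simp
  show mu: "mu_bar n = (if squarefull n then 1 else 0)" by (rule mu_bar_eq[OF n])
  have "(\<Sum>k\<in>Reg n. cis (2 * pi * real k / real n)) = (if squarefull n then 1 else 0)"
    using sum_cis_Reg_squarefull sum_cis_Reg_not_squarefull[OF n] by simp
  \<comment> \<open>The exponential sum and \<open>mu_bar n\<close> have been evaluated
    independently, both as the indicator of squarefull \<open>n\<close>; real parts turn this into a
    cosine sum.\<close>
  then have "Re (\<Sum>k\<in>Reg n. cis (2 * pi * real k / real n)) = real_of_int (mu_bar n)"
    by (simp add: mu)
  then have S: "(\<Sum>k\<in>Reg n. cos (2 * pi * real k / real n)) = real_of_int (mu_bar n)"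
    by simp
  have "(cos (real k * pi / real n))\<^sup>2 = (1 + cos (2 * pi * real k / real n)) / 2" for k
    using cos_double_cos[of "real k * pi / real n"] by (simp add: mult_ac)
  then have "(\<Sum>k\<in>Reg n. (cos (real k * pi / real n))\<^sup>2)
      = (\<Sum>k\<in>Reg n. (1 + cos (2 * pi * real k / real n)) / 2)"
    by (rule sum.cong[OF refl])
  then show "(\<Sum>k\<in>Reg n. (cos (real k * pi / real n))\<^sup>2)
      = (real (varrho n) + real_of_int (mu_bar n)) / 2"
    by (simp add: sum_divide_distrib[symmetric] sum.distrib S varrho_def)
qed

end
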